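(* Consider the following proof-producing variant of the Dutertre–de Moura simplex procedure for linear rational arithmetic. The input is a finite set of inequalities, each of the form $l_k \le \sum_h \hat a_{kh} y_h$ or $u_k \ge \sum_h \hat a_{kh} y_h$ over rational variables $y_h$ with rational constants $l_k,u_k,\hat a_{kh}$. For every distinct term $\sum_h \hat a_{kh} y_h$ occurring in the input, a fresh slack variable $s_k$ is introduced: every input inequality is replaced by the corresponding elementary atom $l_k \le s_k$ (resp. $u_k \ge s_k$), and the equation $s_k = \sum_h \hat a_{kh} y_h$ is added. Initially the set of basic variables $\mathcal B$ is the set of slack variables and the set of non-basic variables $\mathcal N$ is the set of the $y_h$'s. The procedure maintains a tableau $T = \{ x_i = \sum_{x_j\in\mathcal N} a_{ij} x_j \mid x_i \in \mathcal B\}$, obtained from the initial one by pivoting so that it always has exactly the same rational solutions as the initial set of equations, together with an assignment $\beta$ with $\beta(x_i)=\sum_{x_j\in\mathcal N} a_{ij}\beta(x_j)$ for $x_i\in\mathcal B$ and with every non-basic variable within its current bounds. Suppose that the procedure reports a conflict from the row $x_i = \sum_{x_j\in\mathcal N} a_{ij}x_j$ of the current tableau because of an elementary atom $x_i \ge l_i$, i.e. $\beta(x_i) < l_i$, and, writing $\mathcal N^+ = \{x_j\in\mathcal N \mid a_{ij}>0\}$ and $\mathcal N^- = \{x_j\in\mathcal N\mid a_{ij}<0\}$, for every $x_j\in\mathcal N^+$ there is an elementary atom $x_j\le u_j$ with $\beta(x_j)=u_j$, and for every $x_j\in\mathcal N^-$ there is an elementary atom $x_j \ge l_j$ with $\beta(x_j)=l_j$.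 Let $$\eta = \{x_j \le u_j \mid x_j\in\mathcal N^+\}\cup\{x_j\ge l_j\mid x_j\in\mathcal N^-\}\cup\{x_i\ge l_i\}.$$ Then $x_i$ and all the $x_j$ occurring in $\eta$ are slack variables introduced by the preprocessing step. Moreover, the set $\eta' = \eta_{\mathcal N^+}\cup\eta_{\mathcal N^-}\cup\eta_i$, where $\eta_{\mathcal N^+} = \{u_k \ge \sum_h \hat a_{kh}y_h \mid s_k \equiv x_j,\ x_j\in\mathcal N^+\}$, $\eta_{\mathcal N^-} = \{l_k \le \sum_h \hat a_{kh}y_h \mid s_k\equiv x_j,\ x_j\in\mathcal N^-\}$, $\eta_i = \{l_k\le \sum_h \hat a_{kh}y_h \mid s_k\equiv x_i\}$, is a conflict set, i.e. it is unsatisfiable over the rationals.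
   Context: Here $s_k \equiv x_j$ means that the variable $x_j$ is the slack variable $s_k$ associated with the term $\sum_h \hat a_{kh} y_h$; thus $\eta'$ is obtained from $\eta$ by replacing each elementary atom on a slack variable by the corresponding original input inequality. *)

theory Defs
  imports Complex_Main "HOL-Library.Poly_Mapping"
begin

text \<open>
  A linear term \<open>\<Sum>\<^sub>h a\<^sub>h y\<^sub>h\<close> over variables of type \<open>'v\<close> is its finitely supported
  coefficient function.
\<close>

type_synonym 'v linterm = "'v \<Rightarrow>\<^sub>0 rat"

definition eval_linterm :: "('v \<Rightarrow> rat) \<Rightarrow> 'v linterm \<Rightarrow> rat" where
  "eval_linterm v t = (\<Sum>y\<in>Poly_Mapping.keys t. Poly_Mapping.lookup t y * v y)"

text \<open>
  Input inequalities have type \<open>'v linterm bnd\<close>; elementary atoms have type \<open>'v bnd\<close>.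
\<close>

datatype 'a bnd =
    AtMost (subject: 'a) rat
  | AtLeast (subject: 'a) rat

fun bnd_holds :: "('a \<Rightarrow> rat) \<Rightarrow> 'a bnd \<Rightarrow> bool" where
  "bnd_holds f (AtMost a u) \<longleftrightarrow> u \<ge> f a"
| "bnd_holds f (AtLeast a l) \<longleftrightarrow> l \<le> f a"

definition unsat :: "'v linterm bnd set \<Rightarrow> bool" where
  "unsat C \<longleftrightarrow> \<not> (\<exists>v :: 'v \<Rightarrow> rat. \<forall>c\<in>C. bnd_holds (eval_linterm v) c)"


subsection \<open>Preprocessing\<close>

text \<open>
  The slack variable introduced for the term \<open>t\<close> is \<open>slack t\<close>. Injectivity is only demanded on
  the terms that occur in the input \<open>P\<close>; \<open>Y\<close> is the set of all the \<open>y\<^sub>h\<close>.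
\<close>

definition slack_vars :: "'v linterm bnd set \<Rightarrow> ('v linterm \<Rightarrow> 'v) \<Rightarrow> 'v set" where
  "slack_vars P slack = slack ` subject ` P"

definition fresh_slacks ::
    "'v linterm bnd set \<Rightarrow> 'v set \<Rightarrow> ('v linterm \<Rightarrow> 'v) \<Rightarrow> bool" where
  "fresh_slacks P Y slack \<longleftrightarrow>
     inj_on slack (subject ` P) \<and> slack_vars P slack \<inter> Y = {}"

definition elementary_atoms ::
    "'v linterm bnd set \<Rightarrow> ('v linterm \<Rightarrow> 'v) \<Rightarrow> 'v bnd set" where
  "elementary_atoms P slack = map_bnd slack ` P"


subsection \<open>Tableaux and pivoting\<close>

text \<open>
  Only the entries \<open>coeff T x y\<close> with \<open>x\<close> basic and \<open>y\<close> non-basic carry meaning.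
\<close>

record 'v tableau =
  basic :: "'v set"
  nonbasic :: "'v set"
  coeff :: "'v \<Rightarrow> 'v \<Rightarrow> rat"

definition satisfies_tableau :: "('v \<Rightarrow> rat) \<Rightarrow> 'v tableau \<Rightarrow> bool" where
  "satisfies_tableau v T \<longleftrightarrow>
     (\<forall>x\<in>basic T. v x = (\<Sum>y\<in>nonbasic T. coeff T x y * v y))"

definition initial_tableau ::
    "'v linterm bnd set \<Rightarrow> 'v set \<Rightarrow> ('v linterm \<Rightarrow> 'v) \<Rightarrow> 'v tableau" where
  "initial_tableau P Y slack =
     \<lparr> basic = slack_vars P slack,
       nonbasic = Y,
       coeff = (\<lambda>s. Poly_Mapping.lookup (inv_into (subject ` P) slack s)) \<rparr>"

text \<open>
  Pivoting solves the row of \<open>x\<close> for \<open>y\<close>, giving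
  \<open>y = (1/a\<^sub>x\<^sub>y) x - \<Sum>\<^sub>z\<^sub>\<noteq>\<^sub>y (a\<^sub>x\<^sub>z/a\<^sub>x\<^sub>y) z\<close>, and substitutes this for \<open>y\<close> in all other rows.
\<close>

definition pivot :: "'v \<Rightarrow> 'v \<Rightarrow> 'v tableau \<Rightarrow> 'v tableau" where
  "pivot x y T = (let a = coeff T in
     \<lparr> basic = insert y (basic T - {x}),
       nonbasic = insert x (nonbasic T - {y}),
       coeff = (\<lambda>r z.
         if r = y then (if z = x then 1 / a x y else - (a x z / a x y))
         else (if z = x then a r y / a x y else a r z - a r y * (a x z / a x y))) \<rparr>)"

inductive pivot_step :: "'v tableau \<Rightarrow> 'v tableau \<Rightarrow> bool" where
  "x \<in> basic T \<Longrightarrow> y \<in> nonbasic T \<Longrightarrow> coeff T x y \<noteq> 0 \<Longrightarrow> pivot_step T (pivot x y T)"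


subsection \<open>States of the procedure and conflicts\<close>

text \<open>
  \<open>\<Gamma>\<close> is the set of elementary atoms that make up the current bounds. That \<open>T\<close> has the same
  solutions as the initial tableau is a consequence of being reached by pivoting and is therefore
  not a separate requirement.
\<close>

definition simplex_state ::
    "'v linterm bnd set \<Rightarrow> 'v set \<Rightarrow> ('v linterm \<Rightarrow> 'v) \<Rightarrow>
     'v tableau \<Rightarrow> 'v bnd set \<Rightarrow> ('v \<Rightarrow> rat) \<Rightarrow> bool" where
  "simplex_state P Y slack T \<Gamma> \<beta> \<longleftrightarrow>
     pivot_step\<^sup>*\<^sup>* (initial_tableau P Y slack) T \<and>
     \<Gamma> \<subseteq> elementary_atoms P slack \<and>
     satisfies_tableau \<beta> T \<and>
     (\<forall>b\<in>\<Gamma>. subject b \<in> nonbasic T \<longrightarrow> bnd_holds \<beta> b)"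

definition nonbasic_pos :: "'v tableau \<Rightarrow> 'v \<Rightarrow> 'v set" where
  "nonbasic_pos T x = {y \<in> nonbasic T. coeff T x y > 0}"

definition nonbasic_neg :: "'v tableau \<Rightarrow> 'v \<Rightarrow> 'v set" where
  "nonbasic_neg T x = {y \<in> nonbasic T. coeff T x y < 0}"

text \<open>
  In the following, \<open>l\<close> and \<open>u\<close> give the bounds of the atoms that take part in the conflict; several
  input inequalities may bound the same term.
\<close>

definition lower_conflict ::
    "'v tableau \<Rightarrow> 'v bnd set \<Rightarrow> ('v \<Rightarrow> rat) \<Rightarrow> ('v \<Rightarrow> rat) \<Rightarrow> ('v \<Rightarrow> rat) \<Rightarrow> 'v \<Rightarrow> bool" where
  "lower_conflict T \<Gamma> \<beta> l u x \<longleftrightarrow>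
     x \<in> basic T \<and> AtLeast x (l x) \<in> \<Gamma> \<and> \<beta> x < l x \<and>
     (\<forall>y\<in>nonbasic_pos T x. AtMost y (u y) \<in> \<Gamma> \<and> \<beta> y = u y) \<and>
     (\<forall>y\<in>nonbasic_neg T x. AtLeast y (l y) \<in> \<Gamma> \<and> \<beta> y = l y)"

definition conflict_atoms ::
    "'v tableau \<Rightarrow> ('v \<Rightarrow> rat) \<Rightarrow> ('v \<Rightarrow> rat) \<Rightarrow> 'v \<Rightarrow> 'v bnd set" where
  "conflict_atoms T l u x =
     {AtMost y (u y) | y. y \<in> nonbasic_pos T x} \<union>
     {AtLeast y (l y) | y. y \<in> nonbasic_neg T x} \<union>
     {AtLeast x (l x)}"

text \<open>
  The conditions \<open>\<in> P\<close> restrict \<open>\<eta>'\<close> to inequalities that literally occur in the input.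
\<close>

definition conflict_inputs ::
    "'v linterm bnd set \<Rightarrow> ('v linterm \<Rightarrow> 'v) \<Rightarrow>
     'v tableau \<Rightarrow> ('v \<Rightarrow> rat) \<Rightarrow> ('v \<Rightarrow> rat) \<Rightarrow> 'v \<Rightarrow> 'v linterm bnd set" where
  "conflict_inputs P slack T l u x =
     {AtMost t (u y) | t y. AtMost t (u y) \<in> P \<and> slack t = y \<and> y \<in> nonbasic_pos T x} \<union>
     {AtLeast t (l y) | t y. AtLeast t (l y) \<in> P \<and> slack t = y \<and> y \<in> nonbasic_neg T x} \<union>
     {AtLeast t (l x) | t. AtLeast t (l x) \<in> P \<and> slack t = x}"

end

theory Submission
  imports Defs
begin

text \<open>
  A rational model of the explaining inequalities, extended to the slack variables by the values of
  their terms, solves the initial tableau and hence, as pivoting preserves solutions, the current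
  one. In the conflicting row every summand \<open>a\<^sub>i\<^sub>j x\<^sub>j\<close> is then at most its value under \<open>\<beta>\<close>, so \<open>x\<^sub>i\<close> is
  at most \<open>\<beta>(x\<^sub>i) < l\<^sub>i\<close>, contradicting \<open>x\<^sub>i \<ge> l\<^sub>i\<close>.
\<close>

text \<open>Coefficients vanish off the support. This turns the value of an input term into a sum
  over all of \<open>Y\<close>, the shape of an initial tableau row.\<close>

lemma eval_linterm_superset:
  assumes "finite A" and "Poly_Mapping.keys t \<subseteq> A"
  shows "eval_linterm v t = (\<Sum>y\<in>A. Poly_Mapping.lookup t y * v y)"
  unfolding eval_linterm_def
  by (rule sum.mono_neutral_left) (use assms in \<open>auto simp: in_keys_iff\<close>)

text \<open>The invariant of pivoting: finiteness keeps the row sums meaningful, and disjointness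
  makes the leaving variable a genuinely new column.\<close>

definition tableau_wf :: "'v tableau \<Rightarrow> bool" where
  "tableau_wf T \<longleftrightarrow> finite (nonbasic T) \<and> basic T \<inter> nonbasic T = {}"

lemma tableau_wf_pivot:
  assumes "tableau_wf T" and "x \<in> basic T" and "y \<in> nonbasic T"
  shows "tableau_wf (pivot x y T)"
  using assms unfolding tableau_wf_def pivot_def Let_def by auto

text \<open>The new rows are linear consequences of the old ones: one is the row of \<open>x\<close>
  solved for \<open>y\<close>, the others result from substituting it.\<close>

lemma satisfies_tableau_pivot:
  assumes "tableau_wf T" and x: "x \<in> basic T" and y: "y \<in> nonbasic T"
    and nz: "coeff T x y \<noteq> 0" and sat: "satisfies_tableau v T"
  shows "satisfies_tableau v (pivot x y T)"
proof -
  let ?a = "coeff T" and ?N = "nonbasic T - {y}"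
  have fin: "finite (nonbasic T)" and xN: "x \<notin> ?N" and yB: "y \<notin> basic T"
    using assms unfolding tableau_wf_def by auto
  \<comment> \<open>Splitting off the column of \<open>y\<close> leaves a sum over
    \<open>?N\<close>, the columns common to the old and the new tableau.\<close>
  have row: "v r = ?a r y * v y + (\<Sum>z\<in>?N. ?a r z * v z)" if "r \<in> basic T" for r
    using sat that sum.remove[OF fin y] unfolding satisfies_tableau_def by metis
  have y_eq: "v y = v x / ?a x y - (\<Sum>z\<in>?N. ?a x z * v z) / ?a x y"
    using row[OF x] nz by (simp add: field_simps)
  have ne: "z \<noteq> x" if "z \<in> ?N" for z
    using that xN by auto
  show ?thesis
    unfolding satisfies_tableau_def
  proof
    fix r
    assume "r \<in> basic (pivot x y T)"
    then consider "r = y" | "r \<in> basic T" "r \<noteq> y"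
      by (auto simp: pivot_def Let_def)
    then have "v r = coeff (pivot x y T) r x * v x
        + (\<Sum>z\<in>?N. coeff (pivot x y T) r z * v z)"
    proof cases
      case 1
      have "(\<Sum>z\<in>?N. coeff (pivot x y T) r z * v z) = (\<Sum>z\<in>?N. - (?a x z * v z / ?a x y))"
        by (rule sum.cong) (use 1 xN in \<open>auto simp: pivot_def Let_def\<close>)
      also have "\<dots> = - ((\<Sum>z\<in>?N. ?a x z * v z) / ?a x y)"
        by (simp add: sum_negf sum_divide_distrib)
      finally show ?thesis
        using y_eq 1 by (simp add: pivot_def Let_def)
    next
      case 2
      have "(\<Sum>z\<in>?N. coeff (pivot x y T) r z * v z)
          = (\<Sum>z\<in>?N. ?a r z * v z - ?a r y / ?a x y * (?a x z * v z))"
        by (rule sum.cong) (use 2 xN in \<open>auto simp: pivot_def Let_def algebra_simps\<close>)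
      also have "\<dots> = (\<Sum>z\<in>?N. ?a r z * v z) - ?a r y / ?a x y * (\<Sum>z\<in>?N. ?a x z * v z)"
        by (simp add: sum_subtractf sum_distrib_left)
      \<comment> \<open>Substituting \<open>y_eq\<close> for \<open>v y\<close> in the old row of
        \<open>r\<close> yields exactly these new coefficients.\<close>
      finally show ?thesis
        using row[OF 2(1)] y_eq 2(2) by (simp add: pivot_def Let_def algebra_simps)
    qed
    also have "\<dots> = (\<Sum>z\<in>insert x ?N. coeff (pivot x y T) r z * v z)"
      using fin xN by (subst sum.insert) auto
    finally show "v r = (\<Sum>z\<in>nonbasic (pivot x y T). coeff (pivot x y T) r z * v z)"
      by (simp add: pivot_def Let_def)
  qed
qed

lemma satisfies_tableau_pivot_steps:
  assumes "pivot_step\<^sup>*\<^sup>* T T'" and "tableau_wf T" and "satisfies_tableau v T"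
  shows "satisfies_tableau v T'"
proof -
  \<comment> \<open>Well-formedness is carried through the induction because every single pivot
    relies on it.\<close>
  from assms have "tableau_wf T' \<and> satisfies_tableau v T'"
    by (induction rule: rtranclp_induct)
      (auto elim!: pivot_step.cases intro: tableau_wf_pivot satisfies_tableau_pivot)
  then show ?thesis by blast
qed

text \<open>Original and slack variables share one type, so the values of \<open>v\<close> at slack
  variables are overwritten; \<open>inv_into\<close> recovers the term that a slack variable stands
  for.\<close>

definition slack_extension ::
    "'v linterm bnd set \<Rightarrow> ('v linterm \<Rightarrow> 'v) \<Rightarrow> ('v \<Rightarrow> rat) \<Rightarrow> 'v \<Rightarrow> rat" where
  "slack_extension P slack v z =
     (if z \<in> slack_vars P slack then eval_linterm v (inv_into (subject ` P) slack z) else v z)"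

lemma slack_extension_slack:
  assumes "fresh_slacks P Y slack" and "t \<in> subject ` P"
  shows "slack_extension P slack v (slack t) = eval_linterm v t"
  using assms by (simp add: slack_extension_def slack_vars_def fresh_slacks_def)

lemma slack_extension_initial_tableau:
  assumes "finite Y" and "\<forall>t\<in>subject ` P. Poly_Mapping.keys t \<subseteq> Y"
    and fresh: "fresh_slacks P Y slack"
  shows "satisfies_tableau (slack_extension P slack v) (initial_tableau P Y slack)"
  unfolding satisfies_tableau_def
proof
  fix s
  assume "s \<in> basic (initial_tableau P Y slack)"
  then obtain t where t: "t \<in> subject ` P" and s: "s = slack t"
    by (auto simp: initial_tableau_def slack_vars_def)
  have inv: "inv_into (subject ` P) slack s = t"
    using t s fresh by (simp add: fresh_slacks_def)
  \<comment> \<open>Freshness keeps \<open>Y\<close> clear of the overwritten variables.\<close>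
  have "slack_extension P slack v y = v y" if "y \<in> Y" for y
    using that fresh by (auto simp: slack_extension_def fresh_slacks_def)
  then have "eval_linterm v t
      = (\<Sum>y\<in>Y. Poly_Mapping.lookup t y * slack_extension P slack v y)"
    using eval_linterm_superset[of Y t v] assms t by simp
  then show "slack_extension P slack v s = (\<Sum>y\<in>nonbasic (initial_tableau P Y slack).
      coeff (initial_tableau P Y slack) s y * slack_extension P slack v y)"
    using slack_extension_slack[OF fresh t] inv s by (simp add: initial_tableau_def)
qed

text \<open>\<open>map_bnd\<close> preserves the constructor and the constant, so each atom goes
  back to an input inequality with the same bound. This meets the membership conditions in
  \<open>conflict_inputs\<close>.\<close>

lemma elementary_atom_AtMostE:
  assumes "AtMost y c \<in> elementary_atoms P slack"
  obtains t where "AtMost t c \<in> P" and "slack t = y"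
proof -
  from assms obtain b where "b \<in> P" and "map_bnd slack b = AtMost y c"
    by (auto simp: elementary_atoms_def)
  then show thesis using that by (cases b) auto
qed

lemma elementary_atom_AtLeastE:
  assumes "AtLeast y c \<in> elementary_atoms P slack"
  obtains t where "AtLeast t c \<in> P" and "slack t = y"
proof -
  from assms obtain b where "b \<in> P" and "map_bnd slack b = AtLeast y c"
    by (auto simp: elementary_atoms_def)
  then show thesis using that by (cases b) auto
qed

text \<open>Preprocessing moves every bound onto a slack variable, so original variables never carry
  one; hence every variable of a conflict is a slack variable.\<close>

lemma subject_elementary_atom:
  assumes "b \<in> elementary_atoms P slack"
  shows "subject b \<in> slack_vars P slack"
proof -
  from assms obtain c where c: "c \<in> P" and b: "b = map_bnd slack c"
    by (auto simp: elementary_atoms_def)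
  have "subject b = slack (subject c)"
    unfolding b by (cases c) auto
  with c show ?thesis by (simp add: slack_vars_def)
qed

lemma conflict_atoms_subset:
  assumes "lower_conflict T \<Gamma> \<beta> l u x"
  shows "conflict_atoms T l u x \<subseteq> \<Gamma>"
  using assms by (auto simp: lower_conflict_def conflict_atoms_def)

text \<open>The rows are compared summand by summand: a negative coefficient reverses the
  inequality, and a zero coefficient removes the variable from the row.\<close>

lemma conflict_row_le:
  assumes "satisfies_tableau w T" and "satisfies_tableau \<beta> T" and "x \<in> basic T"
    and "\<And>y. y \<in> nonbasic_pos T x \<Longrightarrow> w y \<le> \<beta> y"
    and "\<And>y. y \<in> nonbasic_neg T x \<Longrightarrow> \<beta> y \<le> w y"
  shows "w x \<le> \<beta> x"
proof -
  have "coeff T x y * w y \<le> coeff T x y * \<beta> y" if "y \<in> nonbasic T" for y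
    using that assms(4,5)[of y]
    by (cases "coeff T x y" "0 :: rat" rule: linorder_cases)
      (auto simp: nonbasic_pos_def nonbasic_neg_def)
  then have "(\<Sum>y\<in>nonbasic T. coeff T x y * w y) \<le> (\<Sum>y\<in>nonbasic T. coeff T x y * \<beta> y)"
    by (rule sum_mono)
  then show ?thesis
    using assms(1-3) by (simp add: satisfies_tableau_def)
qed

text \<open>Each atom is the image of an explaining input inequality, and the extension gives a
  slack variable the value of its term, so truth carries over.\<close>

lemma slack_extension_conflict_atoms:
  assumes fresh: "fresh_slacks P Y slack"
    and atoms: "conflict_atoms T l u x \<subseteq> elementary_atoms P slack"
    and v: "\<forall>c\<in>conflict_inputs P slack T l u x. bnd_holds (eval_linterm v) c"
    and b: "b \<in> conflict_atoms T l u x"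
  shows "bnd_holds (slack_extension P slack v) b"
proof -
  have "\<exists>c\<in>conflict_inputs P slack T l u x. c \<in> P \<and> b = map_bnd slack c"
  proof (cases b)
    case (AtMost y c)
    with atoms b obtain t where "AtMost t c \<in> P" "slack t = y"
      by (blast elim: elementary_atom_AtMostE)
    with AtMost b show ?thesis
      by (intro bexI[of _ "AtMost t c"]) (auto simp: conflict_atoms_def conflict_inputs_def)
  next
    case (AtLeast y c)
    with atoms b obtain t where "AtLeast t c \<in> P" "slack t = y"
      by (blast elim: elementary_atom_AtLeastE)
    with AtLeast b show ?thesis
      by (intro bexI[of _ "AtLeast t c"]) (auto simp: conflict_atoms_def conflict_inputs_def)
  qed
  then obtain c where "bnd_holds (eval_linterm v) c" "c \<in> P" "b = map_bnd slack c"
    using v by blast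
  moreover from \<open>c \<in> P\<close> have
    "slack_extension P slack v (slack (subject c)) = eval_linterm v (subject c)"
    by (intro slack_extension_slack[OF fresh]) simp
  ultimately show ?thesis by (cases c) auto
qed

theorem mainTheorem1:
  fixes P :: "'v linterm bnd set"
    and Y :: "'v set"
    and slack :: "'v linterm \<Rightarrow> 'v"
    and T :: "'v tableau"
    and \<Gamma> :: "'v bnd set"
    and \<beta> l u :: "'v \<Rightarrow> rat"
    and x\<^sub>i :: 'v
  assumes "finite P"
    and "finite Y"
    and "\<forall>t\<in>subject ` P. Poly_Mapping.keys t \<subseteq> Y"
    and "fresh_slacks P Y slack"
    and "simplex_state P Y slack T \<Gamma> \<beta>"
    and "lower_conflict T \<Gamma> \<beta> l u x\<^sub>i"
  shows "x\<^sub>i \<in> slack_vars P slack \<and>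
         subject ` conflict_atoms T l u x\<^sub>i \<subseteq> slack_vars P slack \<and>
         unsat (conflict_inputs P slack T l u x\<^sub>i)"
proof -
  have steps: "pivot_step\<^sup>*\<^sup>* (initial_tableau P Y slack) T" and \<beta>: "satisfies_tableau \<beta> T"
    and \<Gamma>: "\<Gamma> \<subseteq> elementary_atoms P slack"
    using assms(5) by (auto simp: simplex_state_def)
  have atoms: "conflict_atoms T l u x\<^sub>i \<subseteq> elementary_atoms P slack"
    using conflict_atoms_subset[OF assms(6)] \<Gamma> by blast
  then have slacks: "subject ` conflict_atoms T l u x\<^sub>i \<subseteq> slack_vars P slack"
    using subject_elementary_atom by fastforce
  moreover have "x\<^sub>i \<in> subject ` conflict_atoms T l u x\<^sub>i"
    by (force simp: conflict_atoms_def)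
  moreover have "unsat (conflict_inputs P slack T l u x\<^sub>i)"
    unfolding unsat_def
  proof
    assume "\<exists>v. \<forall>c\<in>conflict_inputs P slack T l u x\<^sub>i. bnd_holds (eval_linterm v) c"
    then obtain v where
      v: "\<forall>c\<in>conflict_inputs P slack T l u x\<^sub>i. bnd_holds (eval_linterm v) c" ..
    define w where "w = slack_extension P slack v"
    have w: "bnd_holds w b" if "b \<in> conflict_atoms T l u x\<^sub>i" for b
      unfolding w_def by (rule slack_extension_conflict_atoms[OF assms(4) atoms v that])
    have "tableau_wf (initial_tableau P Y slack)"
      using assms(2,4) by (simp add: tableau_wf_def initial_tableau_def fresh_slacks_def)
    then have wT: "satisfies_tableau w T"
      unfolding w_def
      using satisfies_tableau_pivot_steps[OF steps] slack_extension_initial_tableau[OF assms(2-4)]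
      by blast
    have "w x\<^sub>i \<le> \<beta> x\<^sub>i"
    proof (rule conflict_row_le[OF wT \<beta>])
      show "x\<^sub>i \<in> basic T"
        using assms(6) by (simp add: lower_conflict_def)
      \<comment> \<open>The atom bounds \<open>w y\<close> by \<open>u y\<close>, and in a conflict
        \<open>\<beta> y\<close> sits exactly at that bound; the negative case is symmetric.\<close>
      show "w y \<le> \<beta> y" if "y \<in> nonbasic_pos T x\<^sub>i" for y
        using w[of "AtMost y (u y)"] that assms(6)
        by (auto simp: conflict_atoms_def lower_conflict_def)
      show "\<beta> y \<le> w y" if "y \<in> nonbasic_neg T x\<^sub>i" for y
        using w[of "AtLeast y (l y)"] that assms(6)
        by (auto simp: conflict_atoms_def lower_conflict_def)
    qed
    moreover have "l x\<^sub>i \<le> w x\<^sub>i"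
      using w[of "AtLeast x\<^sub>i (l x\<^sub>i)"] by (simp add: conflict_atoms_def)
    ultimately show False
      using assms(6) by (simp add: lower_conflict_def)
  qed
  ultimately show ?thesis by blast
qed

end
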